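(* Up to second order, the equation $$u_{t}-u_{txx}=4uu_{x}+2u_{x}^{2}+2uu_{xx}-6u_{x}u_{xx}-2uu_{xxx}$$ admits the following conserved currents $(C^0,C^1)$ (each depending on derivatives of $u$ of order at most two): $$\big(u-u_{xx},\ 2u_x^2-2u^2-2uu_x+2uu_{xx}\big),$$ $$\big(e^{-2x}(u+2u_x+u_{xx}),\ 2e^{-2x}(u_t-3u_x^2-3uu_x+u_{tx}-3uu_{xx})\big),$$ and, for any $f\in C^1(\mathbb{R})$, $$\big(f(t)e^{x}(u-u_{xx}),\ e^x\left[f(t)(2u_{x}^{2}-4uu_{x}+2uu_{xx})-f'(t)(u-u_x)\right]\big).$$
   Context: Here $u=u(t,x)$ is a real-valued function of two independent real variables. A conserved current of the equation is a pair $(C^0,C^1)$ of functions of $t,x,u$ and finitely many derivatives of $u$, vanishing when $u$ and all its derivatives are set to zero, such that $D_tC^0+D_xC^1=0$ holds on all (smooth) solutions $u$ of the equation, where $D_t$ and $D_x$ denote the total derivatives with respect to $t$ and $x$. *)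

theory Defs
  imports "HOL-Analysis.Analysis" "HOL-Library.Groups_Big_Fun"
begin

(* A point J of the (infinite) jet space assigns to the index (i, j) the coordinate
   standing for the derivative of u taken i times in t and j times in x.
   A differential function is a function of t, x and such a point. *)
type_synonym jet = "nat \<times> nat \<Rightarrow> real"
type_synonym diff_fun = "real \<Rightarrow> real \<Rightarrow> jet \<Rightarrow> real"

abbreviation ju :: "jet \<Rightarrow> real" where "ju J \<equiv> J (0, 0)"
abbreviation ju_t :: "jet \<Rightarrow> real" where "ju_t J \<equiv> J (1, 0)"
abbreviation ju_x :: "jet \<Rightarrow> real" where "ju_x J \<equiv> J (0, 1)"
abbreviation ju_tx :: "jet \<Rightarrow> real" where "ju_tx J \<equiv> J (1, 1)"
abbreviation ju_xx :: "jet \<Rightarrow> real" where "ju_xx J \<equiv> J (0, 2)"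
abbreviation ju_txx :: "jet \<Rightarrow> real" where "ju_txx J \<equiv> J (1, 2)"
abbreviation ju_xxx :: "jet \<Rightarrow> real" where "ju_xxx J \<equiv> J (0, 3)"

definition jet_order_le :: "nat \<Rightarrow> diff_fun \<Rightarrow> bool" where
  "jet_order_le n F \<longleftrightarrow>
     (\<forall>t x J J'. (\<forall>i j. i + j \<le> n \<longrightarrow> J (i, j) = J' (i, j)) \<longrightarrow> F t x J = F t x J')"

definition pderiv_t :: "diff_fun \<Rightarrow> diff_fun" where
  "pderiv_t F t x J = deriv (\<lambda>s. F s x J) t"

definition pderiv_x :: "diff_fun \<Rightarrow> diff_fun" where
  "pderiv_x F t x J = deriv (\<lambda>s. F t s J) x"

definition pderiv_jet :: "nat \<times> nat \<Rightarrow> diff_fun \<Rightarrow> diff_fun" where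
  "pderiv_jet p F t x J = deriv (\<lambda>s. F t x (J(p := s))) (J p)"

(* D_t and D_x.  For F of finite order only finitely many summands are nonzero,
   so Sum_any is the usual sum over all jet coordinates. *)
definition total_t :: "diff_fun \<Rightarrow> diff_fun" where
  "total_t F t x J =
     pderiv_t F t x J + Sum_any (\<lambda>(i, j). J (Suc i, j) * pderiv_jet (i, j) F t x J)"

definition total_x :: "diff_fun \<Rightarrow> diff_fun" where
  "total_x F t x J =
     pderiv_x F t x J + Sum_any (\<lambda>(i, j). J (i, Suc j) * pderiv_jet (i, j) F t x J)"

(* Regularity under which total_t (resp. total_x) is meaningful: the partial derivatives
   occurring in it exist and are jointly continuous (jets carry the product topology).
   Differentiability in the other independent variable is deliberately not required:
   a flux may contain f'(t) with f only continuously differentiable. *)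
definition jet_C1 :: "diff_fun \<Rightarrow> bool" where
  "jet_C1 F \<longleftrightarrow>
     (\<forall>p. (\<forall>t x J. (\<lambda>s. F t x (J(p := s))) differentiable (at (J p))) \<and>
          continuous_on UNIV (\<lambda>(t, x, J). pderiv_jet p F t x J))"

definition C1_for_total_t :: "diff_fun \<Rightarrow> bool" where
  "C1_for_total_t F \<longleftrightarrow> jet_C1 F \<and>
     (\<forall>t x J. (\<lambda>s. F s x J) differentiable (at t)) \<and>
     continuous_on UNIV (\<lambda>(t, x, J). pderiv_t F t x J)"

definition C1_for_total_x :: "diff_fun \<Rightarrow> bool" where
  "C1_for_total_x F \<longleftrightarrow> jet_C1 F \<and>
     (\<forall>t x J. (\<lambda>s. F t s J) differentiable (at x)) \<and>
     continuous_on UNIV (\<lambda>(t, x, J). pderiv_x F t x J)"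

definition diff_t :: "(real \<Rightarrow> real \<Rightarrow> real) \<Rightarrow> real \<Rightarrow> real \<Rightarrow> real" where
  "diff_t u t x = deriv (\<lambda>s. u s x) t"

definition diff_x :: "(real \<Rightarrow> real \<Rightarrow> real) \<Rightarrow> real \<Rightarrow> real \<Rightarrow> real" where
  "diff_x u t x = deriv (\<lambda>s. u t s) x"

primrec Ck_on :: "nat \<Rightarrow> (real \<times> real) set \<Rightarrow> (real \<Rightarrow> real \<Rightarrow> real) \<Rightarrow> bool" where
  "Ck_on 0 \<Omega> u \<longleftrightarrow> continuous_on \<Omega> (\<lambda>(t, x). u t x)"
| "Ck_on (Suc k) \<Omega> u \<longleftrightarrow> continuous_on \<Omega> (\<lambda>(t, x). u t x) \<and>
     (\<forall>(t, x)\<in>\<Omega>. (\<lambda>s. u s x) differentiable (at t) \<and> (\<lambda>s. u t s) differentiable (at x)) \<and>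
     Ck_on k \<Omega> (diff_t u) \<and> Ck_on k \<Omega> (diff_x u)"

definition smooth_on :: "(real \<times> real) set \<Rightarrow> (real \<Rightarrow> real \<Rightarrow> real) \<Rightarrow> bool" where
  "smooth_on \<Omega> u \<longleftrightarrow> (\<forall>k. Ck_on k \<Omega> u)"

definition prolong :: "(real \<Rightarrow> real \<Rightarrow> real) \<Rightarrow> real \<Rightarrow> real \<Rightarrow> jet" where
  "prolong u t x = (\<lambda>(i, j). ((diff_x ^^ j) ((diff_t ^^ i) u)) t x)"

(* A differential equation is given as a relation E t x J. *)
definition smooth_solution_on ::
  "(real \<Rightarrow> real \<Rightarrow> jet \<Rightarrow> bool) \<Rightarrow> (real \<times> real) set \<Rightarrow> (real \<Rightarrow> real \<Rightarrow> real) \<Rightarrow> bool" where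
  "smooth_solution_on E \<Omega> u \<longleftrightarrow> smooth_on \<Omega> u \<and> (\<forall>(t, x)\<in>\<Omega>. E t x (prolong u t x))"

(* Solutions are allowed to be local; \<Omega> = UNIV gives the global ones. *)
definition conserved_current ::
  "(real \<Rightarrow> real \<Rightarrow> jet \<Rightarrow> bool) \<Rightarrow> diff_fun \<Rightarrow> diff_fun \<Rightarrow> bool" where
  "conserved_current E C0 C1 \<longleftrightarrow>
     (\<exists>n. jet_order_le n C0 \<and> jet_order_le n C1) \<and>
     C1_for_total_t C0 \<and> C1_for_total_x C1 \<and>
     (\<forall>t x. C0 t x (\<lambda>_. 0) = 0 \<and> C1 t x (\<lambda>_. 0) = 0) \<and>
     (\<forall>\<Omega> u. open \<Omega> \<longrightarrow> smooth_solution_on E \<Omega> u \<longrightarrow>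
        (\<forall>(t, x)\<in>\<Omega>.
           total_t C0 t x (prolong u t x) + total_x C1 t x (prolong u t x) = 0))"

definition conserved_current_of_order_le ::
  "nat \<Rightarrow> (real \<Rightarrow> real \<Rightarrow> jet \<Rightarrow> bool) \<Rightarrow> diff_fun \<Rightarrow> diff_fun \<Rightarrow> bool" where
  "conserved_current_of_order_le n E C0 C1 \<longleftrightarrow>
     conserved_current E C0 C1 \<and> jet_order_le n C0 \<and> jet_order_le n C1"

definition the_equation :: "real \<Rightarrow> real \<Rightarrow> jet \<Rightarrow> bool" where
  "the_equation t x J \<longleftrightarrow>
     ju_t J - ju_txx J =
       4 * ju J * ju_x J + 2 * (ju_x J)^2 + 2 * ju J * ju_xx J
       - 6 * ju_x J * ju_xx J - 2 * ju J * ju_xxx J"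

end

theory Submission
  imports Defs
begin

text \<open>
  On functions of finitely many jet coordinates the total derivatives are derivations:
  they are linear, satisfy the product rule, and send a jet coordinate to the next one
  (\<open>has_total_t_add\<close>, \<open>has_total_t_mult\<close>, \<open>has_total_t_coord\<close> and their analogues in \<open>x\<close>).
  All six components of the currents are polynomials in the jet coordinates whose
  coefficients are built from functions of \<open>t\<close> alone and of \<open>x\<close> alone, so these rules
  determine \<open>D\<^sub>t C\<^sup>0\<close> and \<open>D\<^sub>x C\<^sup>1\<close> and deliver the regularity of \<open>C\<^sup>0\<close> and \<open>C\<^sup>1\<close> along the way.

  Let \<open>\<Delta>\<close> be the left-hand side minus the right-hand side of the equation.  The sum
  \<open>D\<^sub>t C\<^sup>0 + D\<^sub>x C\<^sup>1\<close> turns out to be a multiple of \<open>\<Delta>\<close> identically on the jet space, the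
  multipliers being \<open>1\<close>, \<open>- 3 e\<^sup>-\<^sup>2\<^sup>x\<close> and \<open>f(t) e\<^sup>x\<close>.  Hence the sum vanishes wherever the
  equation holds, in particular on the prolongation of every solution
  (\<open>conserved_current_of_order_leI\<close>).
\<close>

section \<open>The jet part of a total derivative\<close>

text \<open>
  The parameter \<open>\<sigma>\<close> raises the index of a coordinate by one in \<open>t\<close> or in \<open>x\<close>, which lets both
  total derivatives be treated at once.
\<close>
definition jet_part :: "(nat \<times> nat \<Rightarrow> nat \<times> nat) \<Rightarrow> diff_fun \<Rightarrow> diff_fun" where
  "jet_part \<sigma> F t x J = Sum_any (\<lambda>p. J (\<sigma> p) * pderiv_jet p F t x J)"

lemma total_t_eq_jet_part:
  "total_t F t x J = pderiv_t F t x J + jet_part (\<lambda>(i, j). (Suc i, j)) F t x J"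
  unfolding total_t_def jet_part_def
  by (rule arg_cong[where f = "\<lambda>g. _ + Sum_any g"]) (auto simp: fun_eq_iff)

lemma total_x_eq_jet_part:
  "total_x F t x J = pderiv_x F t x J + jet_part (\<lambda>(i, j). (i, Suc j)) F t x J"
  unfolding total_x_def jet_part_def
  by (rule arg_cong[where f = "\<lambda>g. _ + Sum_any g"]) (auto simp: fun_eq_iff)

lemma finite_indices_of_order_le: "finite {(i, j). i + j \<le> (n :: nat)}"
  by (rule finite_subset[of _ "{..n} \<times> {..n}"]) auto

lemma pderiv_jet_eq_0_above_order:
  assumes "jet_order_le n F" and "i + j > n"
  shows "pderiv_jet (i, j) F t x J = 0"
proof -
  have "F t x (J((i, j) := s)) = F t x J" for s
    using assms unfolding jet_order_le_def by (metis fun_upd_other leD prod.inject)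
  then show ?thesis
    by (simp add: pderiv_jet_def)
qed

text \<open>
  An order bound gives one finite index set that serves \<open>F\<close>, \<open>G\<close>, \<open>F + G\<close> and \<open>F G\<close> alike.  Without
  it \<open>Sum_any\<close>, which is \<open>0\<close> on infinite supports, would not be additive.
\<close>
lemma jet_part_eq_finite_sum:
  assumes "jet_order_le n F"
  shows "jet_part \<sigma> F t x J = (\<Sum>p \<in> {(i, j). i + j \<le> n}. J (\<sigma> p) * pderiv_jet p F t x J)"
  unfolding jet_part_def
proof (rule Sum_any.expand_superset)
  show "{p. J (\<sigma> p) * pderiv_jet p F t x J \<noteq> 0} \<subseteq> {(i, j). i + j \<le> n}"
    using pderiv_jet_eq_0_above_order[OF assms] by (auto, meson not_le)
qed (rule finite_indices_of_order_le)

text \<open>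
  Continuity of the function itself is part of the notion because the product rule expresses
  the partial derivatives of \<open>F G\<close> through the values of \<open>F\<close> and \<open>G\<close>, and the continuity of
  the jet derivatives does not control the dependence on \<open>t\<close> and \<open>x\<close>.
\<close>
definition jet_regular :: "nat \<Rightarrow> diff_fun \<Rightarrow> bool" where
  "jet_regular n F \<longleftrightarrow>
     jet_order_le n F \<and> jet_C1 F \<and> continuous_on UNIV (\<lambda>(t, x, J). F t x J)"

lemma jet_C1_I:
  assumes "\<And>p t x J. ((\<lambda>s. F t x (J(p := s))) has_real_derivative G p t x J) (at (J p))"
    and "\<And>p. continuous_on UNIV (\<lambda>(t, x, J). G p t x J)"
  shows "jet_C1 F" and "pderiv_jet p F t x J = G p t x J"
proof -
  have eq: "pderiv_jet p F t x J = G p t x J" for p t x J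
    unfolding pderiv_jet_def by (rule DERIV_imp_deriv) (rule assms(1))
  then show "pderiv_jet p F t x J = G p t x J" .
  show "jet_C1 F"
    unfolding jet_C1_def eq using assms real_differentiable_def by blast
qed

lemma jet_C1_has_derivative:
  assumes "jet_C1 F"
  shows "((\<lambda>s. F t x (J(p := s))) has_real_derivative pderiv_jet p F t x J) (at (J p))"
  using assms unfolding jet_C1_def pderiv_jet_def
  by (simp add: DERIV_deriv_iff_real_differentiable del: split_paired_All)

lemma jet_C1_continuous: "jet_C1 F \<Longrightarrow> continuous_on UNIV (\<lambda>(t, x, J). pderiv_jet p F t x J)"
  by (simp add: jet_C1_def del: split_paired_All)

lemma jet_regular_coefficient:
  assumes "continuous_on UNIV (\<lambda>(t, x). a t x)"
  shows "jet_regular n (\<lambda>t x J. a t x)" and "jet_part \<sigma> (\<lambda>t x J. a t x) t x J = 0"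
proof -
  note C = jet_C1_I[of "\<lambda>t x J. a t x" "\<lambda>p t x J. 0"]
  have "continuous_on UNIV (\<lambda>z :: real \<times> real \<times> jet. (\<lambda>(t, x). a t x) (fst z, fst (snd z)))"
    by (rule continuous_on_compose2[OF assms]) (auto intro!: continuous_intros)
  then show "jet_regular n (\<lambda>t x J. a t x)"
    unfolding jet_regular_def jet_order_le_def using C(1) by (auto simp: case_prod_beta)
  show "jet_part \<sigma> (\<lambda>t x J. a t x) t x J = 0"
    unfolding jet_part_def using C(2) by simp
qed

lemma continuous_on_jet_coordinate:
  "continuous_on UNIV (\<lambda>(t :: real, x :: real, J :: jet). J q)"
proof -
  have q: "continuous_on UNIV (\<lambda>J :: jet. J q)"
    by (rule continuous_on_product_coordinates)
  have "continuous_on UNIV (\<lambda>z :: real \<times> real \<times> jet. snd (snd z))"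
    by (intro continuous_intros)
  from continuous_on_compose2[OF q this] show ?thesis
    by (simp add: case_prod_beta)
qed

lemma jet_regular_coord:
  assumes "i + j \<le> n"
  shows "jet_regular n (\<lambda>t x J. J (i, j))"
    and "jet_part \<sigma> (\<lambda>t x J. J (i, j)) t x J = J (\<sigma> (i, j))"
proof -
  have D: "((\<lambda>s. (J(p := s)) (i, j)) has_real_derivative (if p = (i, j) then 1 else 0)) (at (J p))"
    for p and J :: jet
    by (cases "p = (i, j)") auto
  note C = jet_C1_I[of "\<lambda>t x J. J (i, j)" "\<lambda>p t x J. if p = (i, j) then 1 else 0", OF D]
  show "jet_regular n (\<lambda>t x J. J (i, j))"
    unfolding jet_regular_def jet_order_le_def
    using C(1) assms continuous_on_jet_coordinate by auto
  have ord: "jet_order_le n (\<lambda>t x J. J (i, j))"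
    using assms by (simp add: jet_order_le_def)
  have "(\<Sum>p \<in> {(i, j). i + j \<le> n}. J (\<sigma> p) * (if p = (i, j) then 1 else 0)) = J (\<sigma> (i, j))"
    using assms finite_indices_of_order_le[of n] by (simp add: if_distrib cong: if_cong)
  then show "jet_part \<sigma> (\<lambda>t x J. J (i, j)) t x J = J (\<sigma> (i, j))"
    unfolding jet_part_eq_finite_sum[OF ord] using C(2) by simp
qed

lemma jet_regular_add:
  assumes F: "jet_regular n F" and G: "jet_regular n G"
  shows "jet_regular n (\<lambda>t x J. F t x J + G t x J)"
    and "jet_part \<sigma> (\<lambda>t x J. F t x J + G t x J) t x J = jet_part \<sigma> F t x J + jet_part \<sigma> G t x J"
proof -
  have ord: "jet_order_le n F" "jet_order_le n G" and C1: "jet_C1 F" "jet_C1 G"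
    and cont: "continuous_on UNIV (\<lambda>(t, x, J). F t x J)" "continuous_on UNIV (\<lambda>(t, x, J). G t x J)"
    using F G by (auto simp: jet_regular_def)
  have ord': "jet_order_le n (\<lambda>t x J. F t x J + G t x J)"
    using ord unfolding jet_order_le_def by metis
  have D: "((\<lambda>s. F t x (J(p := s)) + G t x (J(p := s))) has_real_derivative
      pderiv_jet p F t x J + pderiv_jet p G t x J) (at (J p))" for p t x J
    by (intro DERIV_add jet_C1_has_derivative C1)
  have K: "continuous_on UNIV (\<lambda>(t, x, J). pderiv_jet p F t x J + pderiv_jet p G t x J)" for p
    using continuous_on_add[OF C1[THEN jet_C1_continuous]] by (simp add: case_prod_beta)
  note C = jet_C1_I[of "\<lambda>t x J. F t x J + G t x J", OF D K]
  show "jet_regular n (\<lambda>t x J. F t x J + G t x J)"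
    unfolding jet_regular_def using ord' C(1) continuous_on_add[OF cont]
    by (simp add: case_prod_beta)
  show "jet_part \<sigma> (\<lambda>t x J. F t x J + G t x J) t x J = jet_part \<sigma> F t x J + jet_part \<sigma> G t x J"
    unfolding jet_part_eq_finite_sum[OF ord(1)] jet_part_eq_finite_sum[OF ord(2)]
      jet_part_eq_finite_sum[OF ord'] C(2)
    by (simp add: sum.distrib algebra_simps)
qed

lemma jet_regular_mult:
  assumes F: "jet_regular n F" and G: "jet_regular n G"
  shows "jet_regular n (\<lambda>t x J. F t x J * G t x J)"
    and "jet_part \<sigma> (\<lambda>t x J. F t x J * G t x J) t x J =
      jet_part \<sigma> F t x J * G t x J + F t x J * jet_part \<sigma> G t x J"
proof -
  have ord: "jet_order_le n F" "jet_order_le n G" and C1: "jet_C1 F" "jet_C1 G"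
    and cont: "continuous_on UNIV (\<lambda>(t, x, J). F t x J)" "continuous_on UNIV (\<lambda>(t, x, J). G t x J)"
    using F G by (auto simp: jet_regular_def)
  have ord': "jet_order_le n (\<lambda>t x J. F t x J * G t x J)"
    using ord unfolding jet_order_le_def by metis
  have D: "((\<lambda>s. F t x (J(p := s)) * G t x (J(p := s))) has_real_derivative
      pderiv_jet p F t x J * G t x J + F t x J * pderiv_jet p G t x J) (at (J p))" for p t x J
    using DERIV_mult[OF C1(1)[THEN jet_C1_has_derivative, of t x J p]
      C1(2)[THEN jet_C1_has_derivative, of t x J p]] by (simp add: ac_simps)
  have K: "continuous_on UNIV
      (\<lambda>(t, x, J). pderiv_jet p F t x J * G t x J + F t x J * pderiv_jet p G t x J)" for p
    using continuous_on_add[OF continuous_on_mult[OF jet_C1_continuous[OF C1(1)] cont(2)]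
        continuous_on_mult[OF cont(1) jet_C1_continuous[OF C1(2)]]]
    by (simp add: case_prod_beta)
  note C = jet_C1_I[of "\<lambda>t x J. F t x J * G t x J", OF D K]
  show "jet_regular n (\<lambda>t x J. F t x J * G t x J)"
    unfolding jet_regular_def using ord' C(1) continuous_on_mult[OF cont]
    by (simp add: case_prod_beta)
  show "jet_part \<sigma> (\<lambda>t x J. F t x J * G t x J) t x J =
      jet_part \<sigma> F t x J * G t x J + F t x J * jet_part \<sigma> G t x J"
    unfolding jet_part_eq_finite_sum[OF ord(1)] jet_part_eq_finite_sum[OF ord(2)]
      jet_part_eq_finite_sum[OF ord'] C(2)
    by (simp add: sum.distrib sum_distrib_left sum_distrib_right algebra_simps)
qed

section \<open>Total derivatives as derivations\<close>

text \<open>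
  Regularity is bundled with the value because the sum and product rules can fail for \<open>deriv\<close> at
  points where a factor is not differentiable; in this form the rules can be chained
  syntactically.
\<close>
definition has_total_t :: "nat \<Rightarrow> diff_fun \<Rightarrow> diff_fun \<Rightarrow> bool" where
  "has_total_t n F F' \<longleftrightarrow>
     jet_regular n F \<and> C1_for_total_t F \<and> (\<forall>t x J. total_t F t x J = F' t x J)"

definition has_total_x :: "nat \<Rightarrow> diff_fun \<Rightarrow> diff_fun \<Rightarrow> bool" where
  "has_total_x n F F' \<longleftrightarrow>
     jet_regular n F \<and> C1_for_total_x F \<and> (\<forall>t x J. total_x F t x J = F' t x J)"

lemma has_total_t_eq_rhs:
  "has_total_t n F F' \<Longrightarrow> (\<And>t x J. F' t x J = F'' t x J) \<Longrightarrow> has_total_t n F F''"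
  by (simp add: has_total_t_def)

lemma has_total_x_eq_rhs:
  "has_total_x n F F' \<Longrightarrow> (\<And>t x J. F' t x J = F'' t x J) \<Longrightarrow> has_total_x n F F''"
  by (simp add: has_total_x_def)

lemma has_total_tI:
  assumes "jet_regular n F"
    and D: "\<And>t x J. ((\<lambda>s. F s x J) has_real_derivative G t x J) (at t)"
    and "continuous_on UNIV (\<lambda>(t, x, J). G t x J)"
    and "\<And>t x J. G t x J + jet_part (\<lambda>(i, j). (Suc i, j)) F t x J = F' t x J"
  shows "has_total_t n F F'"
proof -
  have eq: "pderiv_t F t x J = G t x J" for t x J
    unfolding pderiv_t_def by (rule DERIV_imp_deriv) (rule D)
  have "(\<lambda>s. F s x J) differentiable (at t)" for t x J
    using D real_differentiable_def by blast
  then show ?thesis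
    using assms(1,3,4)
    unfolding has_total_t_def C1_for_total_t_def jet_regular_def total_t_eq_jet_part eq
    by simp
qed

lemma has_total_xI:
  assumes "jet_regular n F"
    and D: "\<And>t x J. ((\<lambda>s. F t s J) has_real_derivative G t x J) (at x)"
    and "continuous_on UNIV (\<lambda>(t, x, J). G t x J)"
    and "\<And>t x J. G t x J + jet_part (\<lambda>(i, j). (i, Suc j)) F t x J = F' t x J"
  shows "has_total_x n F F'"
proof -
  have eq: "pderiv_x F t x J = G t x J" for t x J
    unfolding pderiv_x_def by (rule DERIV_imp_deriv) (rule D)
  have "(\<lambda>s. F t s J) differentiable (at x)" for t x J
    using D real_differentiable_def by blast
  then show ?thesis
    using assms(1,3,4)
    unfolding has_total_x_def C1_for_total_x_def jet_regular_def total_x_eq_jet_part eq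
    by simp
qed

lemma has_total_tD:
  assumes "has_total_t n F F'"
  shows "jet_regular n F"
    and "((\<lambda>s. F s x J) has_real_derivative pderiv_t F t x J) (at t)"
    and "continuous_on UNIV (\<lambda>(t, x, J). pderiv_t F t x J)"
    and "continuous_on UNIV (\<lambda>(t, x, J). F t x J)"
    and "F' t x J = pderiv_t F t x J + jet_part (\<lambda>(i, j). (Suc i, j)) F t x J"
  using assms
  by (auto simp: has_total_t_def C1_for_total_t_def jet_regular_def pderiv_t_def
      DERIV_deriv_iff_real_differentiable total_t_eq_jet_part)

lemma has_total_xD:
  assumes "has_total_x n F F'"
  shows "jet_regular n F"
    and "((\<lambda>s. F t s J) has_real_derivative pderiv_x F t x J) (at x)"
    and "continuous_on UNIV (\<lambda>(t, x, J). pderiv_x F t x J)"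
    and "continuous_on UNIV (\<lambda>(t, x, J). F t x J)"
    and "F' t x J = pderiv_x F t x J + jet_part (\<lambda>(i, j). (i, Suc j)) F t x J"
  using assms
  by (auto simp: has_total_x_def C1_for_total_x_def jet_regular_def pderiv_x_def
      DERIV_deriv_iff_real_differentiable total_x_eq_jet_part)

lemma has_total_t_coord:
  assumes "i + j \<le> n"
  shows "has_total_t n (\<lambda>t x J. J (i, j)) (\<lambda>t x J. J (Suc i, j))"
  by (rule has_total_tI[where G = "\<lambda>t x J. 0"])
     (simp_all add: jet_regular_coord[OF assms])

lemma has_total_x_coord:
  assumes "i + j \<le> n"
  shows "has_total_x n (\<lambda>t x J. J (i, j)) (\<lambda>t x J. J (i, Suc j))"
  by (rule has_total_xI[where G = "\<lambda>t x J. 0"])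
     (simp_all add: jet_regular_coord[OF assms])

lemma has_total_t_add:
  assumes F: "has_total_t n F F'" and G: "has_total_t n G G'"
  shows "has_total_t n (\<lambda>t x J. F t x J + G t x J) (\<lambda>t x J. F' t x J + G' t x J)"
proof (rule has_total_tI)
  note f = has_total_tD[OF F] and g = has_total_tD[OF G]
  show "((\<lambda>s. F s x J + G s x J) has_real_derivative pderiv_t F t x J + pderiv_t G t x J) (at t)"
    for t x J
    by (intro DERIV_add f g)
  show "continuous_on UNIV (\<lambda>(t, x, J). pderiv_t F t x J + pderiv_t G t x J)"
    using continuous_on_add[OF f(3) g(3)] by (simp add: case_prod_beta)
qed (simp_all add: has_total_tD[OF F] has_total_tD[OF G]
    jet_regular_add[OF has_total_tD(1)[OF F] has_total_tD(1)[OF G]])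

lemma has_total_x_add:
  assumes F: "has_total_x n F F'" and G: "has_total_x n G G'"
  shows "has_total_x n (\<lambda>t x J. F t x J + G t x J) (\<lambda>t x J. F' t x J + G' t x J)"
proof (rule has_total_xI)
  note f = has_total_xD[OF F] and g = has_total_xD[OF G]
  show "((\<lambda>s. F t s J + G t s J) has_real_derivative pderiv_x F t x J + pderiv_x G t x J) (at x)"
    for t x J
    by (intro DERIV_add f g)
  show "continuous_on UNIV (\<lambda>(t, x, J). pderiv_x F t x J + pderiv_x G t x J)"
    using continuous_on_add[OF f(3) g(3)] by (simp add: case_prod_beta)
qed (simp_all add: has_total_xD[OF F] has_total_xD[OF G]
    jet_regular_add[OF has_total_xD(1)[OF F] has_total_xD(1)[OF G]])

lemma has_total_t_mult:
  assumes F: "has_total_t n F F'" and G: "has_total_t n G G'"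
  shows "has_total_t n (\<lambda>t x J. F t x J * G t x J)
    (\<lambda>t x J. F' t x J * G t x J + F t x J * G' t x J)"
proof (rule has_total_tI)
  note f = has_total_tD[OF F] and g = has_total_tD[OF G]
  show "((\<lambda>s. F s x J * G s x J) has_real_derivative
      pderiv_t F t x J * G t x J + F t x J * pderiv_t G t x J) (at t)" for t x J
    using DERIV_mult[OF f(2)[of x J t] g(2)[of x J t]] by (simp add: ac_simps)
  show "continuous_on UNIV (\<lambda>(t, x, J). pderiv_t F t x J * G t x J + F t x J * pderiv_t G t x J)"
    using continuous_on_add[OF continuous_on_mult[OF f(3) g(4)] continuous_on_mult[OF f(4) g(3)]]
    by (simp add: case_prod_beta)
qed (simp_all add: has_total_tD[OF F] has_total_tD[OF G]
    jet_regular_mult[OF has_total_tD(1)[OF F] has_total_tD(1)[OF G]] algebra_simps)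

lemma has_total_x_mult:
  assumes F: "has_total_x n F F'" and G: "has_total_x n G G'"
  shows "has_total_x n (\<lambda>t x J. F t x J * G t x J)
    (\<lambda>t x J. F' t x J * G t x J + F t x J * G' t x J)"
proof (rule has_total_xI)
  note f = has_total_xD[OF F] and g = has_total_xD[OF G]
  show "((\<lambda>s. F t s J * G t s J) has_real_derivative
      pderiv_x F t x J * G t x J + F t x J * pderiv_x G t x J) (at x)" for t x J
    using DERIV_mult[OF f(2)[of t J x] g(2)[of t J x]] by (simp add: ac_simps)
  show "continuous_on UNIV (\<lambda>(t, x, J). pderiv_x F t x J * G t x J + F t x J * pderiv_x G t x J)"
    using continuous_on_add[OF continuous_on_mult[OF f(3) g(4)] continuous_on_mult[OF f(4) g(3)]]
    by (simp add: case_prod_beta)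
qed (simp_all add: has_total_xD[OF F] has_total_xD[OF G]
    jet_regular_mult[OF has_total_xD(1)[OF F] has_total_xD(1)[OF G]] algebra_simps)

lemma continuous_on_fst_argument:
  "continuous_on UNIV (g :: real \<Rightarrow> real) \<Longrightarrow>
   continuous_on UNIV (\<lambda>(t, y :: 'a :: topological_space). g t)"
  unfolding case_prod_beta by (rule continuous_on_compose2) (auto intro!: continuous_intros)

lemma continuous_on_middle_argument:
  "continuous_on UNIV (g :: real \<Rightarrow> real) \<Longrightarrow>
   continuous_on UNIV (\<lambda>(t :: real, x, y :: 'a :: topological_space). g x)"
  unfolding case_prod_beta by (rule continuous_on_compose2) (auto intro!: continuous_intros)

lemma continuous_on_snd_argument:
  "continuous_on UNIV (g :: real \<Rightarrow> real) \<Longrightarrow> continuous_on UNIV (\<lambda>(t :: real, x). g x)"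
  unfolding case_prod_beta by (rule continuous_on_compose2) (auto intro!: continuous_intros)

text \<open>
  Differentiation in one independent variable asks only for continuity of a coefficient that
  depends on the other one.  This is what admits the coefficient \<open>f'\<close> in a flux when \<open>f\<close> is
  merely continuously differentiable.
\<close>
lemma has_total_x_function_of_t:
  assumes "continuous_on UNIV g"
  shows "has_total_x n (\<lambda>t x J. g t) (\<lambda>t x J. 0)"
  by (rule has_total_xI[where G = "\<lambda>t x J. 0"])
     (simp_all add: jet_regular_coefficient[of "\<lambda>t x. g t"] continuous_on_fst_argument assms)

lemma has_total_t_function_of_x:
  assumes "continuous_on UNIV g"
  shows "has_total_t n (\<lambda>t x J. g x) (\<lambda>t x J. 0)"
  by (rule has_total_tI[where G = "\<lambda>t x J. 0"])
     (simp_all add: jet_regular_coefficient[of "\<lambda>t x. g x"] continuous_on_snd_argument assms)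

lemma has_total_t_function_of_t:
  assumes D: "\<And>t. (g has_real_derivative g' t) (at t)" and "continuous_on UNIV g'"
  shows "has_total_t n (\<lambda>t x J. g t) (\<lambda>t x J. g' t)"
proof -
  have "continuous_on UNIV g"
    using D by (meson DERIV_continuous_on has_field_derivative_at_within)
  moreover have "continuous_on UNIV (\<lambda>(t :: real, x :: real, J :: jet). g' t)"
    using continuous_on_fst_argument[OF assms(2), where 'a = "real \<times> jet"]
    by (simp add: case_prod_beta)
  ultimately show ?thesis
    by (intro has_total_tI[where G = "\<lambda>t x J. g' t"])
       (simp_all add: jet_regular_coefficient[of "\<lambda>t x. g t"] continuous_on_fst_argument assms)
qed

lemma has_total_x_function_of_x:
  assumes D: "\<And>x. (g has_real_derivative g' x) (at x)" and "continuous_on UNIV g'"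
  shows "has_total_x n (\<lambda>t x J. g x) (\<lambda>t x J. g' x)"
proof -
  have "continuous_on UNIV g"
    using D by (meson DERIV_continuous_on has_field_derivative_at_within)
  then show ?thesis
    by (intro has_total_xI[where G = "\<lambda>t x J. g' x"])
       (simp_all add: jet_regular_coefficient[of "\<lambda>t x. g x"] continuous_on_snd_argument
        continuous_on_middle_argument assms)
qed

lemma has_total_t_const: "has_total_t n (\<lambda>t x J. c) (\<lambda>t x J. 0)"
  by (rule has_total_t_function_of_x) simp

lemma has_total_x_const: "has_total_x n (\<lambda>t x J. c) (\<lambda>t x J. 0)"
  by (rule has_total_x_function_of_t) simp

lemma has_total_t_diff:
  assumes "has_total_t n F F'" and "has_total_t n G G'"
  shows "has_total_t n (\<lambda>t x J. F t x J - G t x J) (\<lambda>t x J. F' t x J - G' t x J)"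
  using has_total_t_add[OF assms(1) has_total_t_mult[OF has_total_t_const[of n "- 1"] assms(2)]]
  by simp

lemma has_total_x_diff:
  assumes "has_total_x n F F'" and "has_total_x n G G'"
  shows "has_total_x n (\<lambda>t x J. F t x J - G t x J) (\<lambda>t x J. F' t x J - G' t x J)"
  using has_total_x_add[OF assms(1) has_total_x_mult[OF has_total_x_const[of n "- 1"] assms(2)]]
  by simp

lemma has_total_x_square:
  assumes "has_total_x n F F'"
  shows "has_total_x n (\<lambda>t x J. (F t x J)\<^sup>2) (\<lambda>t x J. 2 * F t x J * F' t x J)"
  by (rule has_total_x_eq_rhs[OF has_total_x_mult[OF assms assms, folded power2_eq_square]])
     simp

lemmas total_t_intros =
  has_total_t_const has_total_t_coord has_total_t_add has_total_t_diff has_total_t_mult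

lemmas total_x_intros =
  has_total_x_const has_total_x_coord has_total_x_add has_total_x_diff has_total_x_square
  has_total_x_mult

section \<open>The three conserved currents\<close>

text \<open>
  Vanishing of the divergence is asked here at every point of the jet space that satisfies the
  equation as an algebraic relation; the prolongation of a solution passes only through such
  points.
\<close>
lemma conserved_current_of_order_leI:
  assumes "has_total_t n C0 D0" and "has_total_x n C1 D1"
    and "\<And>t x. C0 t x (\<lambda>_. 0) = 0" and "\<And>t x. C1 t x (\<lambda>_. 0) = 0"
    and "\<And>t x J. E t x J \<Longrightarrow> D0 t x J + D1 t x J = 0"
  shows "conserved_current_of_order_le n E C0 C1"
  using assms
  unfolding conserved_current_of_order_le_def conserved_current_def has_total_t_def
    has_total_x_def jet_regular_def smooth_solution_on_def
  by (auto simp: case_prod_beta)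

lemma unweighted_current:
  "conserved_current_of_order_le 2 the_equation
     (\<lambda>t x J. ju J - ju_xx J)
     (\<lambda>t x J. 2 * (ju_x J)^2 - 2 * (ju J)^2 - 2 * ju J * ju_x J + 2 * ju J * ju_xx J)"
proof (rule conserved_current_of_order_leI)
  show "has_total_t 2 (\<lambda>t x J. ju J - ju_xx J) (\<lambda>t x J. ju_t J - ju_txx J)"
    by (rule has_total_t_eq_rhs, (rule total_t_intros | simp; fail)+)
  show "has_total_x 2
      (\<lambda>t x J. 2 * (ju_x J)^2 - 2 * (ju J)^2 - 2 * ju J * ju_x J + 2 * ju J * ju_xx J)
      (\<lambda>t x J. - 4 * ju J * ju_x J - 2 * (ju_x J)^2 - 2 * ju J * ju_xx J
        + 6 * ju_x J * ju_xx J + 2 * ju J * ju_xxx J)"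
    \<comment> \<open>The rules produce indices such as \<open>(0, Suc 2)\<close>; writing numerals with \<open>Suc\<close> identifies
       them with \<open>(0, 3)\<close>.\<close>
    by (rule has_total_x_eq_rhs,
        (rule total_x_intros | simp add: numeral_2_eq_2 numeral_3_eq_3
          algebra_simps power2_eq_square; fail)+)
qed (simp_all add: the_equation_def)

lemma exp_minus_2x_current:
  "conserved_current_of_order_le 2 the_equation
     (\<lambda>t x J. exp (- 2 * x) * (ju J + 2 * ju_x J + ju_xx J))
     (\<lambda>t x J. 2 * exp (- 2 * x) *
        (ju_t J - 3 * (ju_x J)^2 - 3 * ju J * ju_x J + ju_tx J - 3 * ju J * ju_xx J))"
proof (rule conserved_current_of_order_leI)
  have exp_t: "has_total_t 2 (\<lambda>t x J. exp (- 2 * x)) (\<lambda>t x J. 0)"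
    by (rule has_total_t_function_of_x) (intro continuous_intros)
  have exp_x: "has_total_x 2 (\<lambda>t x J. exp (- 2 * x)) (\<lambda>t x J. - 2 * exp (- 2 * x))"
    by (rule has_total_x_function_of_x) (auto intro!: derivative_eq_intros continuous_intros)
  show "has_total_t 2 (\<lambda>t x J. exp (- 2 * x) * (ju J + 2 * ju_x J + ju_xx J))
      (\<lambda>t x J. exp (- 2 * x) * (ju_t J + 2 * ju_tx J + ju_txx J))"
    by (rule has_total_t_eq_rhs, (rule exp_t total_t_intros | simp; fail)+)
  show "has_total_x 2
      (\<lambda>t x J. 2 * exp (- 2 * x) *
        (ju_t J - 3 * (ju_x J)^2 - 3 * ju J * ju_x J + ju_tx J - 3 * ju J * ju_xx J))
      (\<lambda>t x J. 2 * exp (- 2 * x) *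
        (- 2 * ju_t J - ju_tx J + ju_txx J + 3 * (ju_x J)^2 + 6 * ju J * ju_x J
          + 3 * ju J * ju_xx J - 9 * ju_x J * ju_xx J - 3 * ju J * ju_xxx J))"
    by (rule has_total_x_eq_rhs,
        (rule exp_x total_x_intros | simp add: numeral_2_eq_2 numeral_3_eq_3
          algebra_simps power2_eq_square; fail)+)
next
  fix t x J
  assume "the_equation t x J"
  then have eq: "ju_t J = ju_txx J + 4 * ju J * ju_x J + 2 * (ju_x J)^2 + 2 * ju J * ju_xx J
      - 6 * ju_x J * ju_xx J - 2 * ju J * ju_xxx J"
    by (simp add: the_equation_def)
  show "exp (- 2 * x) * (ju_t J + 2 * ju_tx J + ju_txx J) +
      2 * exp (- 2 * x) *
        (- 2 * ju_t J - ju_tx J + ju_txx J + 3 * (ju_x J)^2 + 6 * ju J * ju_x J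
          + 3 * ju J * ju_xx J - 9 * ju_x J * ju_xx J - 3 * ju J * ju_xxx J) = 0"
    unfolding eq by (simp add: algebra_simps)
qed simp_all

lemma exp_x_current:
  fixes f :: "real \<Rightarrow> real"
  assumes "f C1_differentiable_on UNIV"
  shows "conserved_current_of_order_le 2 the_equation
     (\<lambda>t x J. f t * exp x * (ju J - ju_xx J))
     (\<lambda>t x J. exp x *
        (f t * (2 * (ju_x J)^2 - 4 * ju J * ju_x J + 2 * ju J * ju_xx J)
         - deriv f t * (ju J - ju_x J)))"
proof (rule conserved_current_of_order_leI)
  have f': "(f has_real_derivative deriv f t) (at t)" for t
    using assms by (simp add: C1_differentiable_on_eq DERIV_deriv_iff_real_differentiable)
  have cont_f': "continuous_on UNIV (deriv f)"
    using assms by (simp add: C1_differentiable_on_eq field_derivative_eq_vector_derivative)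
  have cont_f: "continuous_on UNIV f"
    using f' by (meson DERIV_continuous_on has_field_derivative_at_within)
  have exp_t: "has_total_t 2 (\<lambda>t x J. exp x) (\<lambda>t x J. 0)"
    by (rule has_total_t_function_of_x) (intro continuous_intros)
  have exp_x: "has_total_x 2 (\<lambda>t x J. exp x) (\<lambda>t x J. exp x)"
    by (rule has_total_x_function_of_x) (auto intro!: derivative_eq_intros continuous_intros)
  note f_t = has_total_t_function_of_t[OF f' cont_f', of 2]
    and f_x = has_total_x_function_of_t[OF cont_f, of 2]
    and f'_x = has_total_x_function_of_t[OF cont_f', of 2]
  show "has_total_t 2 (\<lambda>t x J. f t * exp x * (ju J - ju_xx J))
      (\<lambda>t x J. exp x * (deriv f t * (ju J - ju_xx J) + f t * (ju_t J - ju_txx J)))"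
    by (rule has_total_t_eq_rhs,
        (rule f_t exp_t total_t_intros | simp add: algebra_simps; fail)+)
  show "has_total_x 2
      (\<lambda>t x J. exp x *
        (f t * (2 * (ju_x J)^2 - 4 * ju J * ju_x J + 2 * ju J * ju_xx J)
         - deriv f t * (ju J - ju_x J)))
      (\<lambda>t x J. exp x *
        (f t * (- 4 * ju J * ju_x J - 2 * (ju_x J)^2 - 2 * ju J * ju_xx J
            + 6 * ju_x J * ju_xx J + 2 * ju J * ju_xxx J)
          - deriv f t * (ju J - ju_xx J)))"
    by (rule has_total_x_eq_rhs,
        (rule f_x f'_x exp_x total_x_intros | simp add: numeral_2_eq_2 numeral_3_eq_3
          algebra_simps power2_eq_square; fail)+)
next
  fix t x J
  assume "the_equation t x J"
  then have eq: "ju_t J = ju_txx J + 4 * ju J * ju_x J + 2 * (ju_x J)^2 + 2 * ju J * ju_xx J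
      - 6 * ju_x J * ju_xx J - 2 * ju J * ju_xxx J"
    by (simp add: the_equation_def)
  show "exp x * (deriv f t * (ju J - ju_xx J) + f t * (ju_t J - ju_txx J)) +
      exp x *
        (f t * (- 4 * ju J * ju_x J - 2 * (ju_x J)^2 - 2 * ju J * ju_xx J
            + 6 * ju_x J * ju_xx J + 2 * ju J * ju_xxx J)
          - deriv f t * (ju J - ju_xx J)) = 0"
    unfolding eq by (simp add: algebra_simps)
qed simp_all

theorem theorem3p1:
  shows
    "conserved_current_of_order_le 2 the_equation
       (\<lambda>t x J. ju J - ju_xx J)
       (\<lambda>t x J. 2 * (ju_x J)^2 - 2 * (ju J)^2 - 2 * ju J * ju_x J + 2 * ju J * ju_xx J)
     \<and> conserved_current_of_order_le 2 the_equation
       (\<lambda>t x J. exp (- 2 * x) * (ju J + 2 * ju_x J + ju_xx J))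
       (\<lambda>t x J. 2 * exp (- 2 * x) *
          (ju_t J - 3 * (ju_x J)^2 - 3 * ju J * ju_x J + ju_tx J - 3 * ju J * ju_xx J))
     \<and> (\<forall>f :: real \<Rightarrow> real. f C1_differentiable_on UNIV \<longrightarrow>
       conserved_current_of_order_le 2 the_equation
         (\<lambda>t x J. f t * exp x * (ju J - ju_xx J))
         (\<lambda>t x J. exp x *
            (f t * (2 * (ju_x J)^2 - 4 * ju J * ju_x J + 2 * ju J * ju_xx J)
             - deriv f t * (ju J - ju_x J))))"
  using unweighted_current exp_minus_2x_current exp_x_current by blast

end
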